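(* Let $G$ be a nontrivial finite cyclic group of order $n$. Consider the three-player avoidance game on $G$. (1) If $n \equiv 1 \pmod 3$ and there is a prime number $p$ dividing $n$ such that $p \equiv 1 \pmod 3$, then Player 1 has a winning strategy. (2) If $n \equiv 1 \pmod 3$ and every prime number $p$ dividing $n$ satisfies $p \equiv 2 \pmod 3$, then Player 2 has a winning strategy. (3) If $n \equiv 2 \pmod 3$, then Player 1 has a winning strategy. (4) If $n \equiv 0 \pmod 9$, then Player 3 has a winning strategy. (5) If $n \equiv 3 \pmod 9$, then Player 1 has a winning strategy. (6) If $n \equiv 6 \pmod 9$, then Player 2 has a winning strategy.
   Context: The three-player avoidance game on a nontrivial finite group $G$: Players 1, 2, 3 take turns in the cyclic order $1,2,3,1,2,3,\dots$, with Player 1 moving first. On each turn the player selects an element of $G$ that has not previously been selected by anyone. The game ends as soon as the set of all elements selected so far (by all players jointly) generates $G$. The player whose selection causes this is the loser (third place), the player who plays immediately before the loser in the cyclic order is the winner (first place), and the remaining player is the runner-up (second place). Thus if Player 1 wins, Player 3 is runner-up; if Player 2 wins, Player 1 is runner-up; if Player 3 wins, Player 2 is runner-up. Each player prefers winning to being runner-up, and being runner-up to losing; in particular, a player who cannot ensure victory for herself helps the opponent whose victory makes her runner-up. "Player $i$ has a winning strategy" means that Player $i$ is the winner when all three players play optimally with respect to these preferences, i.e. Player $i$ is the winner in the outcome determined by backward induction on this finite perfect-information game (this outcome is unique because each player's preference over the three possible winners is strict). *)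

theory Defs
  imports "HOL-Algebra.Elementary_Groups" "HOL-Number_Theory.Cong"
begin

datatype player = Player1 | Player2 | Player3

fun next_player :: "player \<Rightarrow> player" where
  "next_player Player1 = Player2"
| "next_player Player2 = Player3"
| "next_player Player3 = Player1"

text \<open>
  The winner plays immediately before the loser, so if \<open>w\<close> wins, then \<open>next_player w\<close>
  loses and the runner-up is the player after the loser.
\<close>

definition runner_up :: "player \<Rightarrow> player" where
  "runner_up w = next_player (next_player w)"

definition payoff :: "player \<Rightarrow> player \<Rightarrow> nat" where
  "payoff i w = (if i = w then 2 else if i = runner_up w then 1 else 0)"

text \<open>
  \<open>outcome G p S w\<close>: backward induction from the position in which the elements of \<open>S\<close>
  have been selected and \<open>p\<close> is to move yields the winner \<open>w\<close>.

  In the rule \<open>over\<close>, the selection completing a generating set was made by the player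
  before \<open>p\<close>, who is the loser; so the winner is two places before \<open>p\<close> in the cyclic
  order, which is \<open>next_player p\<close>.  In the rule \<open>move\<close>, \<open>f x\<close> is the backward-induction
  winner after the move \<open>x\<close>, and \<open>m\<close> is a move that is optimal for \<open>p\<close>.
\<close>

inductive outcome :: "('a, 'b) monoid_scheme \<Rightarrow> player \<Rightarrow> 'a set \<Rightarrow> player \<Rightarrow> bool"
  for G (structure) where
  over: "generate G S = carrier G \<Longrightarrow> outcome G p S (next_player p)"
| move: "\<lbrakk>generate G S \<noteq> carrier G;
          \<forall>x \<in> carrier G - S. outcome G (next_player p) (insert x S) (f x);
          m \<in> carrier G - S;
          \<forall>x \<in> carrier G - S. payoff p (f x) \<le> payoff p (f m)\<rbrakk>
         \<Longrightarrow> outcome G p S (f m)"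

definition has_winning_strategy :: "('a, 'b) monoid_scheme \<Rightarrow> player \<Rightarrow> bool" where
  "has_winning_strategy G i \<longleftrightarrow> outcome G Player1 {} i"

text \<open>
  The preferences are strict, so the backward-induction outcome is unique; on a finite group
  it exists.
\<close>

lemma payoff_inj: "payoff p w = payoff p w' \<Longrightarrow> w = w'"
  by (cases p; cases w; cases w') (simp_all add: payoff_def runner_up_def)

lemma outcome_unique: "outcome G p S w \<Longrightarrow> outcome G p S w' \<Longrightarrow> w = w'"
proof (induction arbitrary: w' rule: outcome.induct)
  case (over S p)
  from over.prems over.hyps show ?case
    by (cases rule: outcome.cases) auto
next
  case (move S p f m)
  from move.prems show ?case
  proof (cases rule: outcome.cases)
    case over
    with move.hyps show ?thesis by simp
  next
    case (move g k)
    have eq: "f x = g x" if "x \<in> carrier G - S" for x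
      using that \<open>\<forall>x\<in>carrier G - S. outcome G (next_player p) (insert x S) (g x)\<close> move.IH
      by blast
    have k: "k \<in> carrier G - S" using move by simp
    have "payoff p (f m) = payoff p (g k)"
    proof (rule antisym)
      show "payoff p (f m) \<le> payoff p (g k)"
        using bspec[OF move(5) \<open>m \<in> carrier G - S\<close>] eq[OF \<open>m \<in> carrier G - S\<close>] by simp
      show "payoff p (g k) \<le> payoff p (f m)"
        using bspec[OF \<open>\<forall>x\<in>carrier G - S. payoff p (f x) \<le> payoff p (f m)\<close> k] eq[OF k] by simp
    qed
    then have "f m = g k" by (rule payoff_inj)
    then show ?thesis using move(1) by simp
  qed
qed

lemma (in group) outcome_exists:
  assumes "finite (carrier G)" "S \<subseteq> carrier G"
  shows "\<exists>w. outcome G p S w"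
  using assms(2)
proof (induction "card (carrier G - S)" arbitrary: S p rule: less_induct)
  case less
  show ?case
  proof (cases "generate G S = carrier G")
    case True
    then show ?thesis by (blast intro: outcome.over)
  next
    case False
    have fin: "finite (carrier G - S)" using assms(1) by simp
    have ne: "carrier G - S \<noteq> {}"
    proof
      assume "carrier G - S = {}"
      with less.prems have "S = carrier G" by blast
      moreover have "generate G (carrier G) = carrier G"
      proof (rule subset_antisym)
        show "generate G (carrier G) \<subseteq> carrier G" by (rule generate_incl) (rule subset_refl)
        show "carrier G \<subseteq> generate G (carrier G)" by (rule subsetI) (rule generate.incl)
      qed
      ultimately show False using False by simp
    qed
    have "\<exists>w. outcome G (next_player p) (insert x S) w" if "x \<in> carrier G - S" for x
    proof (rule less.hyps)
      show "card (carrier G - insert x S) < card (carrier G - S)"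
        using that fin by (intro psubset_card_mono) auto
      show "insert x S \<subseteq> carrier G" using that less.prems by blast
    qed
    then obtain f where f: "\<forall>x\<in>carrier G - S. outcome G (next_player p) (insert x S) (f x)"
      using bchoice[of "carrier G - S" "\<lambda>x w. outcome G (next_player p) (insert x S) w"]
      by blast
    have "Max ((\<lambda>x. payoff p (f x)) ` (carrier G - S)) \<in> (\<lambda>x. payoff p (f x)) ` (carrier G - S)"
      using fin ne by (intro Max_in) auto
    then obtain m where m: "m \<in> carrier G - S"
      "payoff p (f m) = Max ((\<lambda>x. payoff p (f x)) ` (carrier G - S))" by auto
    then have "\<forall>x\<in>carrier G - S. payoff p (f x) \<le> payoff p (f m)"
      using fin by simp
    with outcome.move[OF False f m(1)] show ?thesis by blast
  qed
qed

end

theory Submission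
  imports Defs "HOL-Algebra.Multiplicative_Group"
begin

text \<open>
  Play stops at the latest when the selected set is a \<^emph>\<open>maximal\<close> non-generating set \<open>M\<close>: the
  next player must then complete a generating set, so the loser, and with her the winner, is
  determined by \<open>card M\<close> modulo 3.  Premature losses do not produce any other outcome.  A player
  who ends the game herself takes the worst payoff, so if she does so optimally although a safe
  move exists, then the safe move has the same worst payoff and hence, the preferences being
  strict, the same winner.  So the winner from a finite non-generating position \<open>S\<close> is the one
  dictated by some maximal non-generating \<open>M \<supseteq> S\<close>, which is \<open>outcome_via_maximal_nongenerating\<close>.

  In a cyclic group of order \<open>n\<close> with generator \<open>a\<close>, the maximal non-generating sets are the
  maximal subgroups.  There is one of order \<open>n / p\<close> for each prime \<open>p\<close> dividing \<open>n\<close>, and it is the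
  only one that contains \<open>a\<^sup>p\<close>.  Hence Player 1 can decide the game with her first move:
  by selecting \<open>a\<^sup>p\<close> she obtains the winner dictated by \<open>n / p\<close>, and conversely the
  actual winner is dictated by \<open>n / q\<close> for some prime \<open>q\<close>.  The winner is therefore the one whom
  Player 1 likes best among those dictated by the numbers \<open>n / p\<close>, and the six cases are read off
  from the residues of these numbers modulo 3: residue 1 means that Player 1 wins, residue 2
  Player 2 and residue 0 Player 3.
\<close>

section \<open>Winners and maximal non-generating sets\<close>

text \<open>
  The player to move after \<open>k\<close> selections.  If a maximal non-generating set with \<open>k\<close> elements has
  been reached, \<open>player_at k\<close> loses and the winner, who moved just before her, is
  \<open>player_at (k + 2)\<close>.
\<close>

definition player_at :: "nat \<Rightarrow> player" where
  "player_at k = (next_player ^^ k) Player1"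

lemma player_at_Suc [simp]: "player_at (Suc k) = next_player (player_at k)"
  by (simp add: player_at_def)

lemma player_at_mod:
  "player_at k = (if k mod 3 = 0 then Player1 else if k mod 3 = 1 then Player2 else Player3)"
  by (induction k) (auto simp: player_at_def mod_Suc)

lemma player_at_plus2:
  "player_at (k + 2) = (if k mod 3 = 0 then Player3 else if k mod 3 = 1 then Player1 else Player2)"
proof -
  have "(k + 2) mod 3 = (if k mod 3 = 0 then 2 else if k mod 3 = 1 then 0 else 1)"
    by presburger
  then show ?thesis
    by (simp add: player_at_mod)
qed

definition maximal_nongenerating :: "('a, 'b) monoid_scheme \<Rightarrow> 'a set \<Rightarrow> bool" where
  "maximal_nongenerating G M \<longleftrightarrow>
     M \<subseteq> carrier G \<and> generate G M \<noteq> carrier G \<and>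
     (\<forall>x \<in> carrier G - M. generate G (insert x M) = carrier G)"

lemma payoff_of_own_loss: "payoff p (next_player (next_player p)) = 0"
  by (cases p) (simp_all add: payoff_def runner_up_def)

text \<open>
  The induction follows an optimal move \<open>m\<close>.  If it is safe, the induction hypothesis applies to
  it.  If it loses, then every safe move has payoff 0 for the mover, so it leads to the same
  winner and the induction hypothesis applies to it; and if there is no safe move, the position
  itself is maximal.
\<close>

lemma outcome_via_maximal_nongenerating:
  assumes "outcome G p S w" and "finite S" and "S \<subseteq> carrier G"
    and "generate G S \<noteq> carrier G" and "p = player_at (card S)"
  shows "\<exists>M. maximal_nongenerating G M \<and> S \<subseteq> M \<and> w = player_at (card M + 2)"
  using assms
proof (induction rule: outcome.induct)
  case (over S p)
  then show ?case by simp
next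
  case (move S p f m)
  have safe: "\<exists>M. maximal_nongenerating G M \<and> S \<subseteq> M \<and> f x = player_at (card M + 2)"
    if x: "x \<in> carrier G - S" and ng: "generate G (insert x S) \<noteq> carrier G" for x
  proof -
    have "\<exists>M. maximal_nongenerating G M \<and> insert x S \<subseteq> M \<and> f x = player_at (card M + 2)"
      using move.IH x ng move.prems by auto
    then show ?thesis by blast
  qed
  show ?case
  proof (cases "generate G (insert m S) = carrier G")
    case False
    with safe move.hyps show ?thesis by blast
  next
    case True
    have "outcome G (next_player p) (insert m S) (f m)"
      using move.IH move.hyps by blast
    then have fm: "f m = next_player (next_player p)"
      using outcome.over[OF True] by (rule outcome_unique)
    show ?thesis
    proof (cases "\<exists>x \<in> carrier G - S. generate G (insert x S) \<noteq> carrier G")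
      case True
      then obtain x where x: "x \<in> carrier G - S" "generate G (insert x S) \<noteq> carrier G"
        by blast
      have "payoff p (f x) \<le> payoff p (f m)"
        using move.hyps x by blast
      then have "payoff p (f x) = payoff p (f m)"
        by (simp add: fm payoff_of_own_loss)
      then have "f x = f m" by (rule payoff_inj)
      with safe[OF x] show ?thesis by simp
    next
      case False
      then have "maximal_nongenerating G S"
        using move.prems by (auto simp: maximal_nongenerating_def)
      then show ?thesis
        using fm move.prems by auto
    qed
  qed
qed

section \<open>Maximal non-generating sets of cyclic groups\<close>

context group
begin

lemma generate_maximal_nongenerating:
  assumes "maximal_nongenerating G M"
  shows "generate G M = M"
proof
  have M: "M \<subseteq> carrier G" and ng: "generate G M \<noteq> carrier G"
    and mx: "\<And>x. x \<in> carrier G - M \<Longrightarrow> generate G (insert x M) = carrier G"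
    using assms by (auto simp: maximal_nongenerating_def)
  show "M \<subseteq> generate G M" by (auto intro: generate.incl)
  show "generate G M \<subseteq> M"
  proof (rule subsetI, rule ccontr)
    fix x assume x: "x \<in> generate G M" "x \<notin> M"
    then have "x \<in> carrier G" using generate_incl[OF M] by blast
    then have "generate G (insert x M) = carrier G" using mx x by blast
    moreover have "generate G (insert x M) \<subseteq> generate G M"
      using x M by (intro generate_subgroup_incl generate_is_subgroup) (auto intro: generate.incl)
    ultimately show False using ng generate_incl[OF M] by blast
  qed
qed

lemma ord_dvd_card_subgroup:
  assumes "subgroup H G" and "x \<in> H"
  shows "ord x dvd card H"
proof -
  have x: "x \<in> carrier G" using assms by (rule subgroup.mem_carrier)
  have "generate G {x} \<subseteq> H" using assms by (simp add: generate_subgroup_incl)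
  then have "subgroup (generate G {x}) (G\<lparr>carrier := H\<rparr>)"
    using generate_is_subgroup[of "{x}"] x assms(1) by (simp add: subgroup_incl)
  from group.lagrange[OF subgroup_imp_group[OF assms(1)] this]
  have "card (generate G {x}) dvd card H" by (simp add: order_def) (metis dvd_triv_right)
  then show ?thesis using generate_pow_card[OF x] by simp
qed

text \<open>
  Let \<open>q\<close> be a prime divisor of the index of \<open>M\<close>.  The elements of exponent \<open>n / q\<close> form a proper
  subgroup containing both \<open>M\<close> and \<open>a\<^sup>q\<close>, so \<open>a\<^sup>q\<close> lies in \<open>M\<close> by maximality.  As
  \<open>a\<^sup>q\<close> has order \<open>n / q\<close>, the order of \<open>M\<close> is both a divisor and a multiple of \<open>n / q\<close>.
\<close>

lemma order_eq_prime_times_card_maximal: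
  assumes fin: "finite (carrier G)" and a: "a \<in> carrier G" and gen: "generate G {a} = carrier G"
    and M: "maximal_nongenerating G M"
  shows "\<exists>q. prime q \<and> order G = q * card M"
proof -
  have Mc: "M \<subseteq> carrier G" and ng: "generate G M \<noteq> carrier G"
    and mx: "\<And>x. x \<in> carrier G - M \<Longrightarrow> generate G (insert x M) = carrier G"
    using M by (auto simp: maximal_nongenerating_def)
  have gM: "generate G M = M" using M by (rule generate_maximal_nongenerating)
  have sub: "subgroup M G" using generate_is_subgroup[OF Mc] gM by simp
  have pos: "order G > 0" using fin by (simp add: order_gt_0_iff_finite)
  have orda: "ord a = order G" using generate_pow_card[OF a] gen by (simp add: order_def)
  obtain r where r: "order G = r * card M"
    using lagrange[OF sub] by metis
  have "r \<noteq> 1"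
  proof
    assume "r = 1"
    then have "M = carrier G" using r fin Mc by (simp add: order_def card_subset_eq)
    with ng gM show False by simp
  qed
  then obtain q where q: "prime q" "q dvd r" using prime_factor_nat by blast
  then obtain s where s: "r = q * s" by blast
  define k where "k = s * card M"
  have n: "order G = q * k" using r s by (simp add: k_def)
  have kpos: "k > 0" using pos n by simp
  have q1: "q > 1" using q prime_gt_1_nat by blast
  define K where "K = {x \<in> carrier G. x [^] k = \<one>}"
  have comm: "x \<otimes> y = y \<otimes> x" if xy: "x \<in> carrier G" "y \<in> carrier G" for x y
  proof -
    obtain i j where "x = a [^] (i::int)" "y = a [^] (j::int)"
      using xy generate_pow[OF a] gen by auto
    then show ?thesis using a by (metis int_pow_mult add.commute)
  qed
  have K: "subgroup K G"
  proof (rule subgroupI)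
    show "K \<subseteq> carrier G" by (auto simp: K_def)
    show "K \<noteq> {}" by (auto simp: K_def intro!: exI[of _ "\<one>"])
    show "inv x \<in> K" if "x \<in> K" for x using that by (auto simp: K_def nat_pow_inv)
    show "x \<otimes> y \<in> K" if "x \<in> K" "y \<in> K" for x y
      using that comm by (auto simp: K_def pow_mult_distrib)
  qed
  have "a \<notin> K"
  proof
    assume "a \<in> K"
    then have "order G dvd k" using pow_eq_id[OF a] orda by (simp add: K_def)
    then have "q * k \<le> k" using n kpos by (metis dvd_imp_le)
    with q1 kpos show False by simp
  qed
  then have Kne: "\<not> carrier G \<subseteq> K" using a by blast
  have "M \<subseteq> K"
  proof
    fix x assume x: "x \<in> M"
    then have xc: "x \<in> carrier G" using Mc by blast
    have "ord x dvd card M" using sub x by (rule ord_dvd_card_subgroup)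
    then have "ord x dvd k" by (simp add: k_def)
    then show "x \<in> K" using xc pow_eq_id by (simp add: K_def)
  qed
  have aq: "a [^] q \<in> K"
    using a pow_order_eq_1[OF a] n by (simp add: K_def nat_pow_pow)
  have "a [^] q \<in> M"
  proof (rule ccontr)
    assume "a [^] q \<notin> M"
    then have "generate G (insert (a [^] q) M) = carrier G" using mx a by simp
    moreover have "generate G (insert (a [^] q) M) \<subseteq> K"
      using aq \<open>M \<subseteq> K\<close> K by (intro generate_subgroup_incl) auto
    ultimately show False using Kne by simp
  qed
  then have "ord (a [^] q) dvd card M" using sub by (intro ord_dvd_card_subgroup)
  moreover have "ord (a [^] q) = k"
    using ord_pow[OF a, of q] orda n q1 by simp
  ultimately have "k dvd card M" by simp
  then have "k = card M" by (simp add: k_def dvd_antisym)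
  then show ?thesis using q n by blast
qed

text \<open>
  If \<open>M\<close> has index \<open>q\<close> and contains \<open>a\<^sup>p\<close>, which has order \<open>n / p\<close>, then \<open>n / p\<close> divides
  \<open>n / q\<close>, so the primes \<open>p\<close> and \<open>q\<close> coincide.
\<close>

lemma card_maximal_containing_prime_power:
  assumes fin: "finite (carrier G)" and a: "a \<in> carrier G" and gen: "generate G {a} = carrier G"
    and M: "maximal_nongenerating G M"
    and p: "prime p" "order G = p * k" and ap: "a [^] p \<in> M"
  shows "card M = k"
proof -
  obtain q where q: "prime q" "order G = q * card M"
    using order_eq_prime_times_card_maximal[OF fin a gen M] by blast
  have pos: "order G > 0" using fin by (simp add: order_gt_0_iff_finite)
  have "subgroup M G"
    using generate_is_subgroup[of M] generate_maximal_nongenerating[OF M] M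
    by (simp add: maximal_nongenerating_def)
  then have "ord (a [^] p) dvd card M" using ap by (rule ord_dvd_card_subgroup)
  moreover have "ord (a [^] p) = k"
    using ord_pow[OF a, of p] generate_pow_card[OF a] gen p prime_gt_0_nat[of p]
    by (simp add: order_def)
  ultimately obtain t where t: "card M = k * t" by blast
  have "k * p = k * (q * t)" using p(2) q(2) t by (metis mult.commute mult.left_commute)
  moreover have "k \<noteq> 0" using pos p(2) by (cases "k = 0") auto
  ultimately have "p = q * t" by (metis mult_left_cancel)
  then have "q = p" using p(1) q(1) by (metis dvd_triv_left primes_dvd_imp_eq)
  then show ?thesis using p q prime_gt_0_nat[of p] by simp
qed

section \<open>Player 1's choice of a maximal subgroup\<close>

text \<open>
  These properties determine the outcome: the winner is dictated by \<open>n / q\<close> for some prime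
  \<open>q\<close>, and Player 1 cannot do better with another prime \<open>p\<close>, because selecting \<open>a\<^sup>p\<close> is among
  her first moves.
\<close>

lemma winner_best_prime_quotient:
  assumes cyc: "cyclic_group G" and fin: "finite (carrier G)" and nontriv: "\<not> trivial_group G"
  obtains w q k where "has_winning_strategy G w"
    and "prime q" and "order G = q * k" and "w = player_at (k + 2)"
    and "\<And>p l. prime p \<Longrightarrow> order G = p * l \<Longrightarrow>
           payoff Player1 (player_at (l + 2)) \<le> payoff Player1 w"
proof -
  obtain a where a: "a \<in> carrier G" and "carrier G = range (\<lambda>i::int. a [^] i)"
    using cyc cyclic_group by blast
  then have gen: "generate G {a} = carrier G"
    using generate_pow[OF a] by auto
  have pos: "order G > 0" using fin by (simp add: order_gt_0_iff_finite)
  have orda: "ord a = order G" using generate_pow_card[OF a] gen by (simp add: order_def)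
  have ng: "generate G {} \<noteq> carrier G"
    using nontriv generate_empty by (metis is_group trivial_group_def)
  obtain w where w: "outcome G Player1 {} w"
    using outcome_exists[OF fin] by blast
  \<comment> \<open>The starting position is not generating, as the group is nontrivial, so the winner is
    dictated by some maximal subgroup.\<close>
  have "\<exists>M. maximal_nongenerating G M \<and> {} \<subseteq> M \<and> w = player_at (card M + 2)"
    by (rule outcome_via_maximal_nongenerating[OF w]) (use ng in \<open>auto simp: player_at_def\<close>)
  then obtain M where M: "maximal_nongenerating G M" "w = player_at (card M + 2)" by blast
  obtain q where q: "prime q" "order G = q * card M"
    using order_eq_prime_times_card_maximal[OF fin a gen M(1)] by blast
  have best: "payoff Player1 (player_at (l + 2)) \<le> payoff Player1 w"
    if p: "prime p" "order G = p * l" for p l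
  proof -
    let ?x = "a [^] p"
    have x: "?x \<in> carrier G - {}" using a by simp
    have "ord ?x = l"
      using ord_pow[OF a, of p] orda p prime_gt_0_nat[of p] by simp
    moreover have "l < order G" using p pos prime_gt_1_nat[of p] by simp
    ultimately have ngx: "generate G {?x} \<noteq> carrier G"
      using generate_pow_card[of ?x] a by (auto simp: order_def)
    from w obtain f where f: "outcome G Player2 {?x} (f ?x)"
      "payoff Player1 (f ?x) \<le> payoff Player1 w"
    proof (cases rule: outcome.cases)
      case over
      then show ?thesis using ng by blast
    next
      case (move f m)
      show ?thesis
      proof (rule that)
        show "outcome G Player2 {?x} (f ?x)" using move x by auto
        show "payoff Player1 (f ?x) \<le> payoff Player1 w" using move x by blast
      qed
    qed
    have "\<exists>M. maximal_nongenerating G M \<and> {?x} \<subseteq> M \<and> f ?x = player_at (card M + 2)"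
      by (rule outcome_via_maximal_nongenerating[OF f(1)])
        (use ngx a in \<open>auto simp: player_at_def\<close>)
    then obtain N where N: "maximal_nongenerating G N" "?x \<in> N" "f ?x = player_at (card N + 2)"
      by blast
    then have "card N = l"
      using card_maximal_containing_prime_power[OF fin a gen N(1) p] by blast
    then show ?thesis using f N by simp
  qed
  show thesis
  proof (rule that)
    show "has_winning_strategy G w" using w by (simp add: has_winning_strategy_def)
  qed (fact q M(2) best)+
qed

end

text \<open>
  The contrapositive supplies a prime divisor congruent to 2 when \<open>n\<close> is congruent to 2, and hence
  a quotient \<open>n / p\<close> congruent to 1.
\<close>

lemma mod_3_eq_1_if_prime_divisors:
  fixes n :: nat
  assumes "n > 0" and "\<And>p. prime p \<Longrightarrow> p dvd n \<Longrightarrow> p mod 3 = 1"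
  shows "n mod 3 = 1"
  using assms
proof (induction n rule: prime_divisors_induct)
  case (factor p n)
  then have "p mod 3 = 1" "n mod 3 = 1" by auto
  then show ?case using mod_mult_eq[of p 3 n] by simp
qed auto

text \<open>
  In each case the numbers \<open>n / p\<close> that can occur, and one that does occur, settle the choice of
  Player 1.  When 3 does not divide \<open>n\<close>, all of them are 1 or 2 modulo 3; when \<open>9\<close> divides
  \<open>n\<close>, all are 0; when 3 divides \<open>n\<close> exactly once, \<open>n / 3\<close> is the only one that is not 0.
\<close>

theorem theorem2p1:
  fixes G :: "('a, 'b) monoid_scheme" (structure)
    and n :: nat
  assumes "group G"
    and "cyclic_group G"
    and "finite (carrier G)"
    and "\<not> trivial_group G"
    and "order G = n"
  shows "([n = 1] (mod 3) \<and> (\<exists>p. prime p \<and> p dvd n \<and> [p = 1] (mod 3))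
            \<longrightarrow> has_winning_strategy G Player1)
       \<and> ([n = 1] (mod 3) \<and> (\<forall>p. prime p \<and> p dvd n \<longrightarrow> [p = 2] (mod 3))
            \<longrightarrow> has_winning_strategy G Player2)
       \<and> ([n = 2] (mod 3) \<longrightarrow> has_winning_strategy G Player1)
       \<and> ([n = 0] (mod 9) \<longrightarrow> has_winning_strategy G Player3)
       \<and> ([n = 3] (mod 9) \<longrightarrow> has_winning_strategy G Player1)
       \<and> ([n = 6] (mod 9) \<longrightarrow> has_winning_strategy G Player2)"
proof -
  interpret group G by fact
  obtain w q k where w: "has_winning_strategy G w"
    and q: "prime q" "order G = q * k" and wk: "w = player_at (k + 2)"
    and best: "\<And>p l. prime p \<Longrightarrow> order G = p * l \<Longrightarrow>
           payoff Player1 (player_at (l + 2)) \<le> payoff Player1 w"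
    using winner_best_prime_quotient[OF assms(2-4)] by blast
  have pos: "n > 0" using assms(3,5) order_gt_0_iff_finite by simp
  have nk: "n = q * k" using q assms by simp
  have nmod: "n mod 3 = ((q mod 3) * (k mod 3)) mod 3"
    unfolding nk by (rule mod_mult_eq[symmetric])
  have three: "3 dvd k" if "3 dvd n" "q \<noteq> 3"
  proof -
    have "prime (3::nat)" by simp
    then show ?thesis using that q nk by (metis prime_dvd_mult_iff primes_dvd_imp_eq)
  qed
  \<comment> \<open>A quotient congruent to 1 lets Player 1 force her own victory; one congruent to 2 lets her
    at least become runner-up, which excludes a victory of Player 3.\<close>
  have p1: "w = Player1" if "prime p" "n = p * l" "l mod 3 = 1" for p l
    using best[of p l] that assms
    by (cases w) (simp_all add: player_at_plus2 payoff_def runner_up_def del: add_2_eq_Suc')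
  have not3: "w \<noteq> Player3" if "prime p" "n = p * l" "l mod 3 = 2" for p l
    using best[of p l] that assms
    by (auto simp: player_at_plus2 payoff_def runner_up_def simp del: add_2_eq_Suc')
  have "w = Player1" if n: "n mod 3 = 1" and p: "prime p" "p dvd n" "p mod 3 = 1" for p
  proof -
    obtain l where l: "n = p * l" using p by blast
    then have "l mod 3 = 1" using n p mod_mult_left_eq[of p 3 l] by simp
    then show ?thesis using p1 p l by blast
  qed
  moreover have "w = Player2"
    if n: "n mod 3 = 1" and all: "\<forall>p. prime p \<and> p dvd n \<longrightarrow> p mod 3 = 2"
  proof -
    have "q mod 3 = 2" using all q nk by simp
    then have "(2 * (k mod 3)) mod 3 = 1" using nmod n by simp
    moreover have "k mod 3 = 0 \<or> k mod 3 = 1 \<or> k mod 3 = 2" by linarith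
    ultimately have "k mod 3 = 2" by auto
    then show ?thesis by (simp add: wk player_at_plus2 del: add_2_eq_Suc')
  qed
  moreover have "w = Player1" if n: "n mod 3 = 2"
  proof -
    obtain p where p: "prime p" "p dvd n" "p mod 3 \<noteq> 1"
      using mod_3_eq_1_if_prime_divisors[OF pos] n by fastforce
    then obtain l where l: "n = p * l" by blast
    have "((p mod 3) * (l mod 3)) mod 3 = 2" using n l mod_mult_eq[of p 3 l] by simp
    moreover have "p mod 3 = 0 \<or> p mod 3 = 2" using p(3) by linarith
    moreover have "l mod 3 = 0 \<or> l mod 3 = 1 \<or> l mod 3 = 2" by linarith
    ultimately have "l mod 3 = 1" by auto
    then show ?thesis using p1 p l by blast
  qed
  moreover have "w = Player3" if n: "n mod 9 = 0"
  proof -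
    have "3 dvd k"
    proof (cases "q = 3")
      case True
      then show ?thesis using n nk by presburger
    next
      case False
      moreover have "3 dvd n" using n by presburger
      ultimately show ?thesis using three by blast
    qed
    then show ?thesis by (simp add: wk player_at_plus2 del: add_2_eq_Suc')
  qed
  moreover have "w = Player1" if n: "n mod 9 = 3"
  proof -
    have "n = 3 * (n div 3)" "(n div 3) mod 3 = 1" using n by presburger+
    then show ?thesis using p1[of 3 "n div 3"] by simp
  qed
  moreover have "w = Player2" if n: "n mod 9 = 6"
  proof -
    have n3: "n = 3 * (n div 3)" "(n div 3) mod 3 = 2" using n by presburger+
    then have "w \<noteq> Player3" using not3[of 3 "n div 3"] by simp
    moreover have "w \<noteq> Player1"
    proof -
      have "k mod 3 \<noteq> 1"
      proof (cases "q = 3")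
        case True
        then have "k = n div 3" using nk by simp
        then show ?thesis using n3 by simp
      next
        case False
        moreover have "3 dvd n" using n by presburger
        ultimately have "3 dvd k" using three by blast
        then show ?thesis by simp
      qed
      then show ?thesis by (simp add: wk player_at_plus2 del: add_2_eq_Suc')
    qed
    ultimately show ?thesis by (cases w) auto
  qed
  moreover have "[n = 1] (mod 3) \<longleftrightarrow> n mod 3 = 1" "[n = 2] (mod 3) \<longleftrightarrow> n mod 3 = 2"
    "[n = 0] (mod 9) \<longleftrightarrow> n mod 9 = 0" "[n = 3] (mod 9) \<longleftrightarrow> n mod 9 = 3"
    "[n = 6] (mod 9) \<longleftrightarrow> n mod 9 = 6"
    "[p = 1] (mod 3) \<longleftrightarrow> p mod 3 = 1" "[p = 2] (mod 3) \<longleftrightarrow> p mod 3 = 2" for p :: nat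
    by (simp_all add: cong_def)
  ultimately show ?thesis
    using w by metis
qed

end
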